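(* Consider a test of a simple null hypothesis $H_0:\theta=\theta_0$. Let the likelihood ratio $g(y,\theta)$ be a continuous and differentiable function on $(a,b)\times\Theta$, the domains of $y$ and $\theta$. Define $$Q(\theta;y)=\frac{\partial g(y,\theta)}{\partial y},$$ and suppose that $Q(\theta;y)$ is either strictly positive for all $y$ and $\theta$ or strictly negative for all $y$ and $\theta$. Let $v\in\{1,-1\}$ denote the sign of $Q(\theta;y)$. For a fixed $\gamma>1$, let $\Lambda=\{(y,\theta): g(y,\theta)-\gamma=0\}$ and suppose $\Lambda\neq\emptyset$. Let $r:\Theta\to\mathbb{R}$ denote a function of $\theta$ such that $(r(\theta),\theta)\in\Lambda$ for every $\theta\in\Theta$. If $$\theta^*=\arg\min_{\theta\in\Theta} v\,r(\theta),$$ then $H_1:\theta=\theta^*$ defines the alternative hypothesis for a UMPBT($\gamma$).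
   Context: Let $\Theta\subseteq\mathbb{R}$ be the parameter space over which alternatives and data-generating parameters range, and let $\theta_0\in\mathbb{R}$ be the null value ($\theta_0$ need not belong to $\Theta$; e.g. $\Theta=\{\theta:\theta>\theta_0\}$ or $\Theta=\{\theta:\theta<\theta_0\}$ for one-sided tests). Let $y\in\mathbb{R}$ be a scalar sufficient statistic of the data, having for each $\theta\in\Theta\cup\{\theta_0\}$ a density $f(y;\theta)$ with respect to a $\sigma$-finite measure $\mu$; the support $S(f)$ of $f$ is assumed not to depend on $\theta$, and $a=\inf S(f)$, $b=\sup S(f)$ in $\mathbb{R}\cup\{-\infty,+\infty\}$. The domain of $y$ is $(a,b)$. Measurability in $(y,\theta)$ is assumed so that the integrals below make sense. $\mathbf{P}_{\theta_t}$ denotes probability when $y$ has density $f(\cdot;\theta_t)$. The likelihood ratio in favor of $\theta$ is $g(y,\theta)=f(y;\theta)/f(y;\theta_0)$. An alternative hypothesis $H_i:\theta\sim\pi_i$ is given by a prior probability distribution $\pi_i$ on $\Theta$ (point masses, i.e. simple alternatives, are allowed). The Bayes factor in favor of $H_i$ against $H_0:\theta=\theta_0$ is $\mathrm{BF}_{i0}(y)=\int_\Theta g(y,\theta)\,\pi_i(d\theta)$; for a simple alternative $H_1:\theta=\theta_1$ it equals $g(y,\theta_1)$. A uniformly most powerful Bayesian test for evidence threshold $\gamma>0$ in favor of $H_1$ against the fixed null $H_0$, denoted UMPBT($\gamma$), is a Bayesian hypothesis test whose Bayes factor satisfies, for every $\theta_t\in\Theta$ and every alternative hypothesis $H_2:\theta\sim\pi_2$,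 $$\mathbf{P}_{\theta_t}[\mathrm{BF}_{10}(y)>\gamma]\ge \mathbf{P}_{\theta_t}[\mathrm{BF}_{20}(y)>\gamma].$$ *)

theory Defs
  imports "HOL-Probability.Probability"
begin

text \<open>
  Throughout, \<open>f y \<theta>\<close> is the density \<open>f(y;\<theta>)\<close> at a real \<open>y\<close>. A density is a chosen pointwise
  version, so its support below is the set where it is positive; passing to the closure would not
  change the infimum and supremum. Points of the support need not carry \<open>\<mu>\<close>-mass, so that for
  instance a binomial density (written with the Gamma function) with respect to counting measure on
  the integers is covered.
\<close>

definition support_set :: "(real \<Rightarrow> real \<Rightarrow> real) \<Rightarrow> real \<Rightarrow> real set" where
  "support_set f \<theta> = {y. f y \<theta> > 0}"

text \<open>The open interval \<open>(a,b)\<close> with \<open>a = inf S(f)\<close>, \<open>b = sup S(f)\<close>; since the support does not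
  depend on the parameter, it is read off at \<open>\<theta>\<^sub>0\<close>.\<close>

definition y_domain :: "(real \<Rightarrow> real \<Rightarrow> real) \<Rightarrow> real \<Rightarrow> real set" where
  "y_domain f \<theta>\<^sub>0 =
     {y. Inf (ereal ` support_set f \<theta>\<^sub>0) < ereal y \<and> ereal y < Sup (ereal ` support_set f \<theta>\<^sub>0)}"

definition sampling_dist ::
  "real measure \<Rightarrow> (real \<Rightarrow> real \<Rightarrow> real) \<Rightarrow> real \<Rightarrow> real measure" where
  "sampling_dist \<mu> f \<theta> = density \<mu> (\<lambda>y. ennreal (f y \<theta>))"

text \<open>The parameter space carries the trace of the Borel \<open>\<sigma>\<close>-algebra; \<open>\<Theta>\<close> itself need not be
  Borel. The assumption \<open>y_in_domain\<close> says that \<open>y\<close> takes its values in the open interval \<open>(a,b)\<close>: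
  an atom at a finite endpoint of the support is excluded.\<close>

locale scalar_model = sigma_finite_measure \<mu> for \<mu> :: "real measure" +
  fixes f :: "real \<Rightarrow> real \<Rightarrow> real" and \<Theta> :: "real set" and \<theta>\<^sub>0 :: real
  assumes sets_\<mu>: "sets \<mu> = sets borel"
    and f_nonneg: "\<And>y \<theta>. \<theta> \<in> insert \<theta>\<^sub>0 \<Theta> \<Longrightarrow> 0 \<le> f y \<theta>"
    and f_null_measurable: "(\<lambda>y. f y \<theta>\<^sub>0) \<in> borel_measurable borel"
    and f_measurable: "(\<lambda>(y, \<theta>). f y \<theta>) \<in> borel_measurable (borel \<Otimes>\<^sub>M restrict_space borel \<Theta>)"
    and f_density: "\<And>\<theta>. \<theta> \<in> insert \<theta>\<^sub>0 \<Theta> \<Longrightarrow> (\<integral>\<^sup>+ y. ennreal (f y \<theta>) \<partial>\<mu>) = 1"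
    and support_const: "\<And>\<theta>. \<theta> \<in> \<Theta> \<Longrightarrow> support_set f \<theta> = support_set f \<theta>\<^sub>0"
    and y_in_domain: "\<And>\<theta>. \<theta> \<in> insert \<theta>\<^sub>0 \<Theta> \<Longrightarrow> AE y in sampling_dist \<mu> f \<theta>. y \<in> y_domain f \<theta>\<^sub>0"

definition likelihood_ratio :: "(real \<Rightarrow> real \<Rightarrow> real) \<Rightarrow> real \<Rightarrow> real \<Rightarrow> real \<Rightarrow> real" where
  "likelihood_ratio f \<theta>\<^sub>0 y \<theta> = f y \<theta> / f y \<theta>\<^sub>0"

definition Q :: "(real \<Rightarrow> real \<Rightarrow> real) \<Rightarrow> real \<Rightarrow> real \<Rightarrow> real \<Rightarrow> real" where
  "Q f \<theta>\<^sub>0 \<theta> y = deriv (\<lambda>y'. likelihood_ratio f \<theta>\<^sub>0 y' \<theta>) y"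

definition Lambda_set ::
  "(real \<Rightarrow> real \<Rightarrow> real) \<Rightarrow> real set \<Rightarrow> real \<Rightarrow> real \<Rightarrow> (real \<times> real) set" where
  "Lambda_set f \<Theta> \<theta>\<^sub>0 \<gamma> =
     {(y, \<theta>). y \<in> y_domain f \<theta>\<^sub>0 \<and> \<theta> \<in> \<Theta> \<and> likelihood_ratio f \<theta>\<^sub>0 y \<theta> - \<gamma> = 0}"

definition prior_on :: "real set \<Rightarrow> real measure \<Rightarrow> bool" where
  "prior_on \<Theta> \<pi> \<longleftrightarrow> prob_space \<pi> \<and> sets \<pi> = sets (restrict_space borel \<Theta>)"

definition simple_alternative :: "real set \<Rightarrow> real \<Rightarrow> real measure" where
  "simple_alternative \<Theta> \<theta> = return (restrict_space borel \<Theta>) \<theta>"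

text \<open>The Bayes factor is \<open>ennreal\<close>-valued because the integral over a prior may diverge; the value
  \<open>\<infinity>\<close> exceeds every threshold.\<close>

definition bayes_factor ::
  "(real \<Rightarrow> real \<Rightarrow> real) \<Rightarrow> real \<Rightarrow> real measure \<Rightarrow> real \<Rightarrow> ennreal" where
  "bayes_factor f \<theta>\<^sub>0 \<pi> y = (\<integral>\<^sup>+ \<theta>. ennreal (likelihood_ratio f \<theta>\<^sub>0 y \<theta>) \<partial>\<pi>)"

text \<open>\<open>UMPBT \<mu> f \<Theta> \<theta>\<^sub>0 \<gamma> \<pi>\<^sub>1\<close>: the alternative \<open>\<theta> \<sim> \<pi>\<^sub>1\<close> defines a UMPBT for evidence threshold
  \<open>\<gamma>\<close> against the null hypothesis \<open>\<theta> = \<theta>\<^sub>0\<close>.\<close>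

definition UMPBT ::
  "real measure \<Rightarrow> (real \<Rightarrow> real \<Rightarrow> real) \<Rightarrow> real set \<Rightarrow> real \<Rightarrow> real \<Rightarrow> real measure \<Rightarrow> bool" where
  "UMPBT \<mu> f \<Theta> \<theta>\<^sub>0 \<gamma> \<pi>\<^sub>1 \<longleftrightarrow>
     \<gamma> > 0 \<and> prior_on \<Theta> \<pi>\<^sub>1 \<and>
     (\<forall>\<theta>\<^sub>t\<in>\<Theta>. \<forall>\<pi>\<^sub>2. prior_on \<Theta> \<pi>\<^sub>2 \<longrightarrow>
        measure (sampling_dist \<mu> f \<theta>\<^sub>t) {y. bayes_factor f \<theta>\<^sub>0 \<pi>\<^sub>1 y > ennreal \<gamma>}
          \<ge> measure (sampling_dist \<mu> f \<theta>\<^sub>t) {y. bayes_factor f \<theta>\<^sub>0 \<pi>\<^sub>2 y > ennreal \<gamma>})"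

text \<open>Sanity checks: the Bayes factor of a simple alternative is the likelihood ratio, and the events
  in the definition of a UMPBT are measurable.\<close>

lemma (in scalar_model) likelihood_ratio_measurable:
  "(\<lambda>(y, \<theta>). likelihood_ratio f \<theta>\<^sub>0 y \<theta>) \<in> borel_measurable (borel \<Otimes>\<^sub>M restrict_space borel \<Theta>)"
proof -
  note [measurable] = f_measurable f_null_measurable
  have "(\<lambda>p. (\<lambda>(y, \<theta>). f y \<theta>) p / f (fst p) \<theta>\<^sub>0)
      \<in> borel_measurable (borel \<Otimes>\<^sub>M restrict_space borel \<Theta>)"
    by measurable
  then show ?thesis
    by (simp add: likelihood_ratio_def case_prod_beta')
qed

lemma (in scalar_model) bayes_factor_simple_alternative:
  assumes "\<theta> \<in> \<Theta>"
  shows "bayes_factor f \<theta>\<^sub>0 (simple_alternative \<Theta> \<theta>) y = ennreal (likelihood_ratio f \<theta>\<^sub>0 y \<theta>)"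
proof -
  have "(\<lambda>\<theta>. (\<lambda>(y, \<theta>). likelihood_ratio f \<theta>\<^sub>0 y \<theta>) (y, \<theta>))
      \<in> borel_measurable (restrict_space borel \<Theta>)"
    by (rule measurable_compose[OF _ likelihood_ratio_measurable]) simp
  then have "(\<lambda>\<theta>. ennreal (likelihood_ratio f \<theta>\<^sub>0 y \<theta>))
      \<in> borel_measurable (restrict_space borel \<Theta>)"
    by simp
  then show ?thesis
    using assms
    by (simp add: bayes_factor_def simple_alternative_def nn_integral_return space_restrict_space)
qed

lemma (in scalar_model) bayes_factor_measurable:
  assumes "prior_on \<Theta> \<pi>"
  shows "bayes_factor f \<theta>\<^sub>0 \<pi> \<in> borel_measurable borel"
proof -
  interpret \<pi>: prob_space \<pi> using assms by (simp add: prior_on_def)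
  have "sets (borel \<Otimes>\<^sub>M \<pi>) = sets (borel \<Otimes>\<^sub>M restrict_space borel \<Theta> :: (real \<times> real) measure)"
    using assms by (intro sets_pair_measure_cong) (simp_all add: prior_on_def)
  then have "(\<lambda>(y, \<theta>). likelihood_ratio f \<theta>\<^sub>0 y \<theta>) \<in> borel_measurable (borel \<Otimes>\<^sub>M \<pi>)"
    using likelihood_ratio_measurable measurable_cong_sets by blast
  then have "(\<lambda>(y, \<theta>). ennreal (likelihood_ratio f \<theta>\<^sub>0 y \<theta>)) \<in> borel_measurable (borel \<Otimes>\<^sub>M \<pi>)"
    by (simp add: case_prod_beta')
  then show ?thesis
    unfolding bayes_factor_def by (rule \<pi>.borel_measurable_nn_integral)
qed

end

theory Submission
  imports Defs
begin

text \<open>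
  Write \<open>g(y,\<theta>)\<close> for the likelihood ratio. For every \<open>\<theta>\<close> it is monotone in \<open>y\<close>, in the direction
  \<open>v\<close> that is common to all \<open>\<theta>\<close>, so a simple alternative \<open>\<theta>\<close> rejects exactly on the half-line of
  those \<open>y\<close> with \<open>v y > v r(\<theta>)\<close>. These half-lines are nested, and minimising \<open>v r(\<theta>)\<close> picks the
  largest one, that of \<open>\<theta>\<^sup>*\<close>. Outside it, \<open>g(y,\<theta>) \<le> \<gamma>\<close> holds for all \<open>\<theta>\<close> at once
  (lemma \<open>likelihood_ratio_strict_mono\<close>), and a Bayes factor is an average of the values
  \<open>g(y,\<theta>)\<close>, so no prior can reject there either (lemma \<open>bayes_factor_le\<close>). Thus the rejection
  region of every alternative is contained, up to a null set, in that of \<open>\<theta>\<^sup>*\<close>, whatever the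
  data-generating parameter (lemma \<open>UMPBT_simple_alternativeI\<close>).
\<close>

lemma open_y_domain: "open (y_domain f \<theta>\<^sub>0)"
proof -
  have "y_domain f \<theta>\<^sub>0 =
      ereal -` {Inf (ereal ` support_set f \<theta>\<^sub>0)<..<Sup (ereal ` support_set f \<theta>\<^sub>0)}"
    by (auto simp: y_domain_def)
  then show ?thesis
    by (simp add: open_ereal_vimage)
qed

lemma y_domain_interval:
  assumes "x \<in> y_domain f \<theta>\<^sub>0" "z \<in> y_domain f \<theta>\<^sub>0" "x \<le> y" "y \<le> z"
  shows "y \<in> y_domain f \<theta>\<^sub>0"
proof -
  have "ereal x \<le> ereal y" "ereal y \<le> ereal z" using assms by simp_all
  with assms(1,2) show ?thesis
    unfolding y_domain_def mem_Collect_eq by (meson less_le_trans le_less_trans)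
qed

text \<open>Joint differentiability is relative to \<open>(a,b) \<times> \<Theta>\<close>, where \<open>\<Theta>\<close> may have no interior; but the
  horizontal slices are open, so along them the derivative is an honest two-sided one. Knowing the
  value of \<open>Q\<close> alone would not do, as it is an unspecified value where \<open>g\<close> is not differentiable.\<close>

lemma likelihood_ratio_has_derivative_Q:
  assumes diff: "(\<lambda>(y, \<theta>). likelihood_ratio f \<theta>\<^sub>0 y \<theta>) differentiable_on (y_domain f \<theta>\<^sub>0 \<times> \<Theta>)"
    and y: "y \<in> y_domain f \<theta>\<^sub>0" and \<theta>: "\<theta> \<in> \<Theta>"
  shows "((\<lambda>y. likelihood_ratio f \<theta>\<^sub>0 y \<theta>) has_real_derivative Q f \<theta>\<^sub>0 \<theta> y) (at y)"
proof -
  let ?D = "y_domain f \<theta>\<^sub>0" and ?g = "\<lambda>(y, \<theta>). likelihood_ratio f \<theta>\<^sub>0 y \<theta>"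
  have "?g differentiable (at (y, \<theta>) within ?D \<times> \<Theta>)"
    using diff y \<theta> by (auto simp: differentiable_on_def)
  then have "?g differentiable (at (y, \<theta>) within (\<lambda>y. (y, \<theta>)) ` ?D)"
    by (rule differentiable_within_subset) (use \<theta> in auto)
  moreover have "(\<lambda>y. (y, \<theta>)) differentiable (at y within ?D)"
    unfolding differentiable_def
    by (rule exI) (rule has_derivative_Pair[OF has_derivative_ident has_derivative_const])
  ultimately have "(?g \<circ> (\<lambda>y. (y, \<theta>))) differentiable (at y within ?D)"
    by (intro differentiable_chain_within)
  then have "(\<lambda>y. likelihood_ratio f \<theta>\<^sub>0 y \<theta>) differentiable (at y)"
    by (simp add: o_def at_within_open[OF y open_y_domain])
  then show ?thesis
    unfolding Q_def by (simp add: DERIV_deriv_iff_real_differentiable)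
qed

text \<open>Scaling by the sign \<open>v\<close> lets the increasing and the decreasing case share one statement.
  Strictness is what makes the rejection region of a simple alternative the whole half-line beyond
  \<open>r(\<theta>)\<close>.\<close>

lemma likelihood_ratio_strict_mono:
  assumes diff: "(\<lambda>(y, \<theta>). likelihood_ratio f \<theta>\<^sub>0 y \<theta>) differentiable_on (y_domain f \<theta>\<^sub>0 \<times> \<Theta>)"
    and v: "v \<in> {1, -1}" and sgn: "\<forall>y\<in>y_domain f \<theta>\<^sub>0. v = sgn (Q f \<theta>\<^sub>0 \<theta> y)"
    and \<theta>: "\<theta> \<in> \<Theta>" and y: "y \<in> y_domain f \<theta>\<^sub>0" and z: "z \<in> y_domain f \<theta>\<^sub>0"
    and less: "v * y < v * z"
  shows "likelihood_ratio f \<theta>\<^sub>0 y \<theta> < likelihood_ratio f \<theta>\<^sub>0 z \<theta>"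
proof -
  note deriv = likelihood_ratio_has_derivative_Q[OF diff _ \<theta>]
  consider "v = 1" | "v = -1" using v by auto
  then show ?thesis
  proof cases
    case 1
    have "\<exists>d. ((\<lambda>y. likelihood_ratio f \<theta>\<^sub>0 y \<theta>) has_real_derivative d) (at x) \<and> 0 < d"
      if "y \<le> x" "x \<le> z" for x
    proof -
      have "x \<in> y_domain f \<theta>\<^sub>0" using y_domain_interval[OF y z that] .
      moreover from this have "0 < Q f \<theta>\<^sub>0 \<theta> x" using sgn 1 by (metis sgn_1_pos)
      ultimately show ?thesis using deriv by blast
    qed
    then show ?thesis
      using 1 less
      by (intro DERIV_pos_imp_increasing[where f = "\<lambda>y. likelihood_ratio f \<theta>\<^sub>0 y \<theta>"]) auto
  next
    case 2
    have "\<exists>d. ((\<lambda>y. likelihood_ratio f \<theta>\<^sub>0 y \<theta>) has_real_derivative d) (at x) \<and> d < 0"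
      if "z \<le> x" "x \<le> y" for x
    proof -
      have "x \<in> y_domain f \<theta>\<^sub>0" using y_domain_interval[OF z y that] .
      moreover from this have "Q f \<theta>\<^sub>0 \<theta> x < 0" using sgn 2 by (metis sgn_1_neg)
      ultimately show ?thesis using deriv by blast
    qed
    then show ?thesis
      using 2 less
      by (intro DERIV_neg_imp_decreasing[where f = "\<lambda>y. likelihood_ratio f \<theta>\<^sub>0 y \<theta>"]) auto
  qed
qed

lemma bayes_factor_le:
  assumes prior: "prior_on \<Theta> \<pi>"
    and le: "\<And>\<theta>. \<theta> \<in> \<Theta> \<Longrightarrow> likelihood_ratio f \<theta>\<^sub>0 y \<theta> \<le> \<gamma>"
  shows "bayes_factor f \<theta>\<^sub>0 \<pi> y \<le> ennreal \<gamma>"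
proof -
  interpret \<pi>: prob_space \<pi> using prior by (simp add: prior_on_def)
  have "space \<pi> = \<Theta>"
    using prior by (auto simp: prior_on_def space_restrict_space dest: sets_eq_imp_space_eq)
  then have "bayes_factor f \<theta>\<^sub>0 \<pi> y \<le> (\<integral>\<^sup>+ \<theta>. ennreal \<gamma> \<partial>\<pi>)"
    unfolding bayes_factor_def by (intro nn_integral_mono ennreal_leI le) auto
  then show ?thesis
    by (simp add: \<pi>.emeasure_space_1)
qed

lemma prior_on_simple_alternative:
  assumes "\<theta> \<in> \<Theta>"
  shows "prior_on \<Theta> (simple_alternative \<Theta> \<theta>)"
  using assms
  by (simp add: prior_on_def simple_alternative_def prob_space_return space_restrict_space)

context scalar_model
begin

lemma prob_space_sampling_dist:
  assumes "\<theta> \<in> \<Theta>"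
  shows "prob_space (sampling_dist \<mu> f \<theta>)"
proof
  have "(\<lambda>y. (\<lambda>(y, \<theta>). f y \<theta>) (y, \<theta>)) \<in> borel_measurable borel"
    by (rule measurable_compose[OF _ f_measurable]) (use assms in \<open>simp add: space_restrict_space\<close>)
  then have "(\<lambda>y. f y \<theta>) \<in> borel_measurable \<mu>"
    by (simp add: measurable_cong_sets[OF sets_\<mu> refl])
  then show "emeasure (sampling_dist \<mu> f \<theta>) (space (sampling_dist \<mu> f \<theta>)) = 1"
    using f_density[of \<theta>] assms
    by (simp add: sampling_dist_def emeasure_density cong: nn_integral_cong)
qed

text \<open>For an alternative that dominates all others in the pointwise sense below, the uniformity in
  the data-generating parameter is automatic, because the rejection regions do not depend
  on it. Only data in \<open>(a,b)\<close> matter, since \<open>y\<close> falls there almost surely.\<close>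

lemma UMPBT_simple_alternativeI:
  assumes \<gamma>: "\<gamma> > 0" and \<theta>s: "\<theta>s \<in> \<Theta>"
    and dominates: "\<And>y \<theta>. \<lbrakk>y \<in> y_domain f \<theta>\<^sub>0; likelihood_ratio f \<theta>\<^sub>0 y \<theta>s \<le> \<gamma>; \<theta> \<in> \<Theta>\<rbrakk>
      \<Longrightarrow> likelihood_ratio f \<theta>\<^sub>0 y \<theta> \<le> \<gamma>"
  shows "UMPBT \<mu> f \<Theta> \<theta>\<^sub>0 \<gamma> (simple_alternative \<Theta> \<theta>s)"
  unfolding UMPBT_def
proof (intro conjI ballI allI impI)
  show "\<gamma> > 0" by fact
  show prior: "prior_on \<Theta> (simple_alternative \<Theta> \<theta>s)"
    using \<theta>s by (rule prior_on_simple_alternative)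
  fix \<theta>\<^sub>t \<pi> assume \<theta>\<^sub>t: "\<theta>\<^sub>t \<in> \<Theta>" and \<pi>: "prior_on \<Theta> \<pi>"
  let ?P = "sampling_dist \<mu> f \<theta>\<^sub>t"
  let ?R = "\<lambda>\<pi>. {y. bayes_factor f \<theta>\<^sub>0 \<pi> y > ennreal \<gamma>}"
  interpret P: prob_space ?P using \<theta>\<^sub>t by (rule prob_space_sampling_dist)
  have "y \<in> ?R (simple_alternative \<Theta> \<theta>s)" if "y \<in> y_domain f \<theta>\<^sub>0" "y \<in> ?R \<pi>" for y
  proof (rule ccontr)
    assume "y \<notin> ?R (simple_alternative \<Theta> \<theta>s)"
    then have "likelihood_ratio f \<theta>\<^sub>0 y \<theta>s \<le> \<gamma>"
      using \<theta>s \<gamma> by (auto simp: bayes_factor_simple_alternative not_less ennreal_le_iff)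
    then have "bayes_factor f \<theta>\<^sub>0 \<pi> y \<le> ennreal \<gamma>"
      using dominates[OF that(1)] by (intro bayes_factor_le[OF \<pi>])
    then show False using that(2) by simp
  qed
  moreover have "AE y in ?P. y \<in> y_domain f \<theta>\<^sub>0"
    using \<theta>\<^sub>t by (intro y_in_domain) simp
  ultimately have "AE y in ?P. y \<in> ?R \<pi> \<longrightarrow> y \<in> ?R (simple_alternative \<Theta> \<theta>s)"
    by - (erule eventually_mono, blast)
  moreover have "?R (simple_alternative \<Theta> \<theta>s) \<in> sets ?P"
  proof -
    note [measurable] = bayes_factor_measurable[OF prior]
    have "?R (simple_alternative \<Theta> \<theta>s) \<in> sets borel" by measurable
    then show ?thesis by (simp add: sampling_dist_def sets_\<mu>)
  qed
  ultimately show "measure ?P (?R \<pi>) \<le> measure ?P (?R (simple_alternative \<Theta> \<theta>s))"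
    by (rule P.finite_measure_mono_AE)
qed

end

theorem theorem2:
  fixes \<mu> :: "real measure"
    and f :: "real \<Rightarrow> real \<Rightarrow> real"
    and \<Theta> :: "real set"
    and \<theta>\<^sub>0 \<gamma> v \<theta>s :: real
    and r :: "real \<Rightarrow> real"
  assumes model: "scalar_model \<mu> f \<Theta> \<theta>\<^sub>0"
    and continuous: "continuous_on (y_domain f \<theta>\<^sub>0 \<times> \<Theta>) (\<lambda>(y, \<theta>). likelihood_ratio f \<theta>\<^sub>0 y \<theta>)"
    and differentiable: "(\<lambda>(y, \<theta>). likelihood_ratio f \<theta>\<^sub>0 y \<theta>) differentiable_on (y_domain f \<theta>\<^sub>0 \<times> \<Theta>)"
    and Q_sign: "(\<forall>y\<in>y_domain f \<theta>\<^sub>0. \<forall>\<theta>\<in>\<Theta>. Q f \<theta>\<^sub>0 \<theta> y > 0)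
                 \<or> (\<forall>y\<in>y_domain f \<theta>\<^sub>0. \<forall>\<theta>\<in>\<Theta>. Q f \<theta>\<^sub>0 \<theta> y < 0)"
    and v: "v \<in> {1, -1}" "\<forall>y\<in>y_domain f \<theta>\<^sub>0. \<forall>\<theta>\<in>\<Theta>. v = sgn (Q f \<theta>\<^sub>0 \<theta> y)"
    and \<gamma>: "\<gamma> > 1"
    and Lambda_nonempty: "Lambda_set f \<Theta> \<theta>\<^sub>0 \<gamma> \<noteq> {}"
    and r: "\<forall>\<theta>\<in>\<Theta>. (r \<theta>, \<theta>) \<in> Lambda_set f \<Theta> \<theta>\<^sub>0 \<gamma>"
    and \<theta>s: "is_arg_min (\<lambda>\<theta>. v * r \<theta>) (\<lambda>\<theta>. \<theta> \<in> \<Theta>) \<theta>s"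
  shows "UMPBT \<mu> f \<Theta> \<theta>\<^sub>0 \<gamma> (simple_alternative \<Theta> \<theta>s)"
proof -
  interpret scalar_model \<mu> f \<Theta> \<theta>\<^sub>0 by (rule model)
  let ?D = "y_domain f \<theta>\<^sub>0" and ?g = "likelihood_ratio f \<theta>\<^sub>0"
  have \<theta>s_in: "\<theta>s \<in> \<Theta>"
    using \<theta>s by (simp add: is_arg_min_linorder)
  have min: "v * r \<theta>s \<le> v * r \<theta>" if "\<theta> \<in> \<Theta>" for \<theta>
    using \<theta>s that by (simp add: is_arg_min_linorder)
  have r_in: "r \<theta> \<in> ?D" and g_r: "?g (r \<theta>) \<theta> = \<gamma>" if "\<theta> \<in> \<Theta>" for \<theta>
    using r that by (auto simp: Lambda_set_def)
  have sgn: "\<forall>y\<in>?D. v = sgn (Q f \<theta>\<^sub>0 \<theta> y)" if "\<theta> \<in> \<Theta>" for \<theta>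
    using v(2) that by blast
  show ?thesis
  proof (rule UMPBT_simple_alternativeI)
    show "\<gamma> > 0" using \<gamma> by simp
    show "\<theta>s \<in> \<Theta>" by (rule \<theta>s_in)
    fix y \<theta> assume y: "y \<in> ?D" and le: "?g y \<theta>s \<le> \<gamma>" and \<theta>: "\<theta> \<in> \<Theta>"
    have "\<not> v * r \<theta>s < v * y"
      using likelihood_ratio_strict_mono[OF differentiable v(1) sgn \<theta>s_in r_in y, OF \<theta>s_in \<theta>s_in]
        g_r[OF \<theta>s_in] le by force
    then have "v * y \<le> v * r \<theta>"
      using min[OF \<theta>] by linarith
    moreover have "y = r \<theta>" if "v * y = v * r \<theta>"
      using that v(1) by auto
    moreover have "?g y \<theta> < ?g (r \<theta>) \<theta>" if "v * y < v * r \<theta>"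
      using likelihood_ratio_strict_mono[OF differentiable v(1) sgn[OF \<theta>] \<theta> y r_in[OF \<theta>] that] .
    ultimately show "?g y \<theta> \<le> \<gamma>"
      using g_r[OF \<theta>] by (cases "v * y = v * r \<theta>") auto
  qed
qed

end
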